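(* Let $\mathcal{V}$ be a finite nonempty set of candidates. For a weak tournament $\mathcal{W}$ over $\mathcal{V}$, let $S(\mathcal{W})\subseteq\mathcal{V}$ be the set of alternatives that lie in the maximal subset of a $K$-way partition obtained by making the minimum number of majority relation reversals to $\mathcal{W}$ (as made precise in the context). Then $S$ is an extension of Slater's rule to weak tournaments; that is, whenever $\mathcal{W}$ is a tournament over $\mathcal{V}$, $S(\mathcal{W})$ equals the set of winners that Slater's rule selects from $\mathcal{W}$.
   Context: Relations are sets of ordered pairs of distinct elements of $\mathcal{V}$. A weak tournament $\mathcal{W}$ over $\mathcal{V}$ is a complete relation: for all distinct $a,b\in\mathcal{V}$, at least one of $(a,b),(b,a)$ is in $\mathcal{W}$. Here $(a,b)\in\mathcal{W}$, $(b,a)\notin\mathcal{W}$ means $a\succ b$ (strict majority), and $(a,b),(b,a)\in\mathcal{W}$ means $a\approx b$ (tie). A tournament is a weak tournament that is also asymmetric: exactly one of $(a,b),(b,a)$ belongs to it for all distinct $a,b$. A relation is identified with the digraph on $\mathcal{V}$ having these pairs as arcs. A majority relation reversal replaces a pair $(a,b)$ of the relation with $(b,a)$ (if $(b,a)$ is already present, this just amounts to deleting $(a,b)$). Thus reversing a set $R\subseteq\mathcal{W}$ produces the relation $(\mathcal{W}\setminus R)\cup\{(b,a):(a,b)\in R\}$, and the number of reversals is $|R|$. Slater's rule: for a tournament $\mathcal{T}$, consider all sets of reversals of minimum cardinality among those whose result is an acyclic tournament (i.e. a linear ordering of $\mathcal{V}$). Slater's rule selects the set of all candidates that are the maximal (top)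 element of at least one linear ordering obtained from such a minimum set of reversals. $K$-way partition: a partition $\{\mathcal{N}_1,\dots,\mathcal{N}_K\}$ of the node set of a digraph is an acyclic $K$-way partition if, for all $u\neq v$, it is not the case that there exist both a directed path from some node of $\mathcal{N}_u$ to some node of $\mathcal{N}_v$ and a directed path from some node of $\mathcal{N}_v$ to some node of $\mathcal{N}_u$. The partitions considered here are acyclic $K$-way partitions (for some $K\ge 1$) in which, in addition, each $\mathcal{N}_t$ induces a complete digraph (both arcs present between every two distinct nodes of $\mathcal{N}_t$). For a complete relation, such a partition, if it exists, is the ordered partition into tie classes of a weak ordering, and its maximal subset is the class all of whose members have arcs to all members of every other class. The solution $S$: consider all sets of reversals $R\subseteq\mathcal{W}$ of minimum cardinality among those whose resulting relation admits such a partition; $S(\mathcal{W})$ is the set of all candidates belonging to the maximal subset of the partition obtained from at least one such minimum $R$. A weak tournament solution $S$ (a map assigning to each weak tournament a set of winners) is an extension of a tournament solution $S'$ if $S(\mathcal{W})=S'(\mathcal{W})$ whenever $\mathcal{W}$ is a tournament. *)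

theory Defs
  imports Main "HOL-Library.Disjoint_Sets"
begin

text \<open>
  A pair \<open>(a, b)\<close> in a relation over \<open>V\<close> means that \<open>a\<close> is at least as good as \<open>b\<close>;
  relations double as loopless digraphs on \<open>V\<close>.
\<close>

definition relation_over :: "'a set \<Rightarrow> 'a rel \<Rightarrow> bool" where
  "relation_over V W \<longleftrightarrow> W \<subseteq> V \<times> V \<and> irrefl W"

definition weak_tournament :: "'a set \<Rightarrow> 'a rel \<Rightarrow> bool" where
  "weak_tournament V W \<longleftrightarrow> relation_over V W \<and> total_on V W"

definition tournament :: "'a set \<Rightarrow> 'a rel \<Rightarrow> bool" where
  "tournament V T \<longleftrightarrow> weak_tournament V T \<and> asym T"

definition reversal :: "'a rel \<Rightarrow> 'a rel \<Rightarrow> 'a rel" where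
  "reversal W R = (W - R) \<union> R\<inverse>"

definition minimum_reversal :: "('a rel \<Rightarrow> bool) \<Rightarrow> 'a rel \<Rightarrow> 'a rel \<Rightarrow> bool" where
  "minimum_reversal Q W R \<longleftrightarrow> is_arg_min card (\<lambda>R. R \<subseteq> W \<and> Q (reversal W R)) R"

definition acyclic_tournament :: "'a set \<Rightarrow> 'a rel \<Rightarrow> bool" where
  "acyclic_tournament V L \<longleftrightarrow> tournament V L \<and> acyclic L"

definition top_element :: "'a set \<Rightarrow> 'a rel \<Rightarrow> 'a \<Rightarrow> bool" where
  "top_element V L a \<longleftrightarrow> a \<in> V \<and> (\<forall>b\<in>V. b \<noteq> a \<longrightarrow> (a, b) \<in> L)"

definition slater :: "'a set \<Rightarrow> 'a rel \<Rightarrow> 'a set" where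
  "slater V T =
     {a. \<exists>R. minimum_reversal (acyclic_tournament V) T R \<and> top_element V (reversal T R) a}"

text \<open>Existence of a directed path between nodes of distinct (disjoint) classes is membership in
  the transitive closure.\<close>

definition path_between :: "'a rel \<Rightarrow> 'a set \<Rightarrow> 'a set \<Rightarrow> bool" where
  "path_between D A B \<longleftrightarrow> (\<exists>a\<in>A. \<exists>b\<in>B. (a, b) \<in> D\<^sup>+)"

definition acyclic_kway_partition :: "nat \<Rightarrow> 'a set \<Rightarrow> 'a rel \<Rightarrow> 'a set set \<Rightarrow> bool" where
  "acyclic_kway_partition K V D P \<longleftrightarrow>
     partition_on V P \<and> finite P \<and> card P = K \<and>
     (\<forall>A\<in>P. \<forall>B\<in>P. A \<noteq> B \<longrightarrow> \<not> (path_between D A B \<and> path_between D B A))"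

definition induces_complete :: "'a rel \<Rightarrow> 'a set \<Rightarrow> bool" where
  "induces_complete D A \<longleftrightarrow> (\<forall>a\<in>A. \<forall>b\<in>A. a \<noteq> b \<longrightarrow> (a, b) \<in> D)"

definition tie_partition :: "'a set \<Rightarrow> 'a rel \<Rightarrow> 'a set set \<Rightarrow> bool" where
  "tie_partition V D P \<longleftrightarrow>
     (\<exists>K\<ge>1. acyclic_kway_partition K V D P) \<and> (\<forall>A\<in>P. induces_complete D A)"

definition maximal_subset :: "'a rel \<Rightarrow> 'a set set \<Rightarrow> 'a set \<Rightarrow> bool" where
  "maximal_subset D P M \<longleftrightarrow>
     M \<in> P \<and> (\<forall>B\<in>P. B \<noteq> M \<longrightarrow> (\<forall>a\<in>M. \<forall>b\<in>B. (a, b) \<in> D))"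

definition kway_solution :: "'a set \<Rightarrow> 'a rel \<Rightarrow> 'a set" where
  "kway_solution V W =
     {a. \<exists>R P M. minimum_reversal (\<lambda>D. \<exists>P. tie_partition V D P) W R \<and>
                 tie_partition V (reversal W R) P \<and>
                 maximal_subset (reversal W R) P M \<and> a \<in> M}"

definition extension_of :: "'a set \<Rightarrow> ('a rel \<Rightarrow> 'a set) \<Rightarrow> ('a rel \<Rightarrow> 'a set) \<Rightarrow> bool" where
  "extension_of V S S' \<longleftrightarrow> (\<forall>W. tournament V W \<longrightarrow> S W = S' W)"

end

theory Submission
  imports Defs
begin

text \<open>Reversing arcs of a tournament yields a tournament, and a tournament has no ties, so its tie
  classes are singletons.  For the partition into singletons, acyclicity of the partition is
  acyclicity of the tournament and the maximal subset consists of the top element.  Hence both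
  rules minimise over the same sets of reversals and read off the same winners.\<close>

text \<open>Each pair of distinct candidates carries exactly one arc of \<open>T\<close>. It is
  swapped if it lies in \<open>R\<close> and kept otherwise, so exactly one arc remains.\<close>

lemma tournament_reversal:
  assumes "tournament V T" "R \<subseteq> T"
  shows "tournament V (reversal T R)"
proof -
  have T: "T \<subseteq> V \<times> V" "irrefl T" "total_on V T" and asym: "\<And>a b. (a, b) \<in> T \<Longrightarrow> (b, a) \<notin> T"
    using assms(1)
    by (auto simp: tournament_def weak_tournament_def relation_over_def dest: asymD)
  show ?thesis
    unfolding tournament_def weak_tournament_def relation_over_def
  proof (intro conjI)
    show "reversal T R \<subseteq> V \<times> V" using T(1) assms(2) by (auto simp: reversal_def)
    show "irrefl (reversal T R)" using T(2) assms(2) by (auto simp: reversal_def irrefl_def)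
    show "total_on V (reversal T R)" using T(3) by (auto simp: reversal_def total_on_def)
    show "asym (reversal T R)" using asym assms(2) by (intro asymI) (auto simp: reversal_def)
  qed
qed

text \<open>Partition acyclicity constrains only distinct classes, so a closed path has to supply a
  second node on it. Irreflexivity makes the successor of \<open>a\<close> such a node.\<close>

lemma irrefl_trancl_cycle:
  assumes "irrefl D" "(a, a) \<in> D\<^sup>+"
  obtains b where "b \<noteq> a" "(a, b) \<in> D\<^sup>+" "(b, a) \<in> D\<^sup>+"
proof -
  obtain b where b: "(a, b) \<in> D" "(b, a) \<in> D\<^sup>*"
    using assms(2) by (meson tranclD)
  then have "b \<noteq> a" using assms(1) by (auto simp: irrefl_def)
  with b that show thesis by (auto simp: rtrancl_eq_or_trancl)
qed

text \<open>Since \<open>P\<close> is determined by \<open>V\<close>, existence of a tie partition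
  reduces to acyclicity, and the choice of \<open>P\<close> in \<open>kway_solution\<close> is
  forced.\<close>

lemma tie_partition_tournament_iff:
  assumes "finite V" "V \<noteq> {}" and D: "tournament V D"
  shows "tie_partition V D P \<longleftrightarrow> P = (\<lambda>a. {a}) ` V \<and> acyclic D"
proof
  have sub: "D \<subseteq> V \<times> V" and "irrefl D" and asym: "\<And>a b. (a, b) \<in> D \<Longrightarrow> (b, a) \<notin> D"
    using D by (auto simp: tournament_def weak_tournament_def relation_over_def dest: asymD)
  show "P = (\<lambda>a. {a}) ` V \<and> acyclic D" if tie: "tie_partition V D P"
  proof -
    from tie have part: "partition_on V P"
      and sep: "\<forall>A\<in>P. \<forall>B\<in>P. A \<noteq> B \<longrightarrow> \<not> (path_between D A B \<and> path_between D B A)"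
      and compl: "\<forall>A\<in>P. induces_complete D A"
      by (simp_all add: tie_partition_def acyclic_kway_partition_def)
    have single: "A = {a}" if "A \<in> P" "a \<in> A" for A a
    proof -
      \<comment> \<open>A second node in a class would give arcs in both directions, against
        asymmetry.\<close>
      have "b = a" if "b \<in> A" for b
        using compl \<open>A \<in> P\<close> \<open>a \<in> A\<close> that asym[of a b]
        by (metis induces_complete_def)
      with that(2) show ?thesis by blast
    qed
    have P: "P = (\<lambda>a. {a}) ` V"
    proof (intro set_eqI iffI)
      fix A assume A: "A \<in> P"
      then obtain a where "a \<in> A"
        using part by (metis partition_onD3 ex_in_conv)
      with A part have "A = {a}" "a \<in> V"
        using single[OF A] by (blast, blast dest: partition_onD1)
      then show "A \<in> (\<lambda>a. {a}) ` V" by blast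
    next
      fix A assume "A \<in> (\<lambda>a. {a}) ` V"
      then obtain a B where "A = {a}" "B \<in> P" "a \<in> B"
        using partition_onD1[OF part] by blast
      with single show "A \<in> P" by metis
    qed
    have "acyclic D"
      unfolding acyclic_def
    proof (intro allI notI)
      fix a assume "(a, a) \<in> D\<^sup>+"
      with \<open>irrefl D\<close> obtain b where b: "b \<noteq> a" "(a, b) \<in> D\<^sup>+" "(b, a) \<in> D\<^sup>+"
        by (rule irrefl_trancl_cycle)
      then have "a \<in> V" "b \<in> V"
        using trancl_subset_Sigma[OF sub] by auto
      with P have "{a} \<in> P" "{b} \<in> P" by auto
      with sep b(1) have "\<not> (path_between D {a} {b} \<and> path_between D {b} {a})" by blast
      with b(2,3) show False by (simp add: path_between_def)
    qed
    with P show ?thesis by simp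
  qed
  show "tie_partition V D P" if P: "P = (\<lambda>a. {a}) ` V \<and> acyclic D"
  proof -
    \<comment> \<open>The witness is \<open>K = card P\<close>; it is at least 1 because
      \<open>V\<close> is finite and nonempty.\<close>
    from P have "partition_on V P" "finite P" "card P \<ge> 1"
      using assms(1,2) by (auto simp: partition_on_def disjoint_def Suc_le_eq card_gt_0_iff)
    \<comment> \<open>Between singletons, the two paths share their end nodes and compose to a
      closed path.\<close>
    moreover have "\<not> (path_between D A B \<and> path_between D B A)" if "A \<in> P" "B \<in> P" for A B
      using that P unfolding path_between_def acyclic_def by (blast intro: trancl_trans)
    moreover have "induces_complete D A" if "A \<in> P" for A
      using that P by (auto simp: induces_complete_def)
    ultimately show ?thesis
      by (auto simp: tie_partition_def acyclic_kway_partition_def)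
  qed
qed

lemma maximal_subset_singletons_iff:
  "(\<exists>M. maximal_subset D ((\<lambda>a. {a}) ` V) M \<and> a \<in> M) \<longleftrightarrow> top_element V D a"
  by (auto simp: maximal_subset_def top_element_def)

text \<open>The two feasibility predicates agree on every \<open>R \<subseteq> T\<close>, because
  \<open>reversal T R\<close> is then a tournament; hence so do the minimisers of
  \<open>card\<close>.\<close>

lemma minimum_reversal_tie_partition_iff:
  assumes "finite V" "V \<noteq> {}" "tournament V T"
  shows "minimum_reversal (\<lambda>D. \<exists>P. tie_partition V D P) T R \<longleftrightarrow>
    minimum_reversal (acyclic_tournament V) T R"
proof -
  have "(\<lambda>R. R \<subseteq> T \<and> (\<exists>P. tie_partition V (reversal T R) P)) =
      (\<lambda>R. R \<subseteq> T \<and> acyclic_tournament V (reversal T R))"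
    using tie_partition_tournament_iff[OF assms(1,2)] tournament_reversal[OF assms(3)]
    by (auto simp: acyclic_tournament_def fun_eq_iff)
  then show ?thesis by (simp add: minimum_reversal_def)
qed

theorem theorem1:
  fixes V :: "'a set"
  assumes "finite V" and "V \<noteq> {}"
  shows "extension_of V (kway_solution V) (slater V)"
  unfolding extension_of_def
proof (intro allI impI)
  fix T assume T: "tournament V T"
  \<comment> \<open>For a fixed minimum \<open>R\<close>, the only possible \<open>P\<close> is the
    partition into singletons, so \<open>M\<close> must be \<open>{a}\<close>.\<close>
  have "(\<exists>P M. tie_partition V (reversal T R) P \<and> maximal_subset (reversal T R) P M \<and> a \<in> M) \<longleftrightarrow>
      top_element V (reversal T R) a"
    if "minimum_reversal (acyclic_tournament V) T R" for R a
  proof -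
    have "R \<subseteq> T" "acyclic (reversal T R)"
      using that by (auto simp: minimum_reversal_def is_arg_min_def acyclic_tournament_def)
    then show ?thesis
      by (simp add: tie_partition_tournament_iff[OF assms tournament_reversal[OF T]]
          maximal_subset_singletons_iff)
  qed
  then show "kway_solution V T = slater V T"
    unfolding kway_solution_def slater_def minimum_reversal_tie_partition_iff[OF assms T]
    by blast
qed

end
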